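(* Let $I\subset\mathbb{R}$ be a nonempty interval, $n\ge 2$, and let $F_n\colon I^n\to I$ be an $n$-associative, monotone increasing, idempotent function with a neutral element. Then $F_n$ is quasitrivial, i.e. $F_n(x_1,\ldots,x_n)\in\{x_1,\ldots,x_n\}$ for all $x_1,\ldots,x_n\in I$.
   Context: A function $F\colon X^n\to X$ is $n$-associative if for all $x_1,\ldots,x_{2n-1}\in X$ and all $i=1,\ldots,n-1$, $F(F(x_1,\ldots,x_n),x_{n+1},\ldots,x_{2n-1})=F(x_1,\ldots,x_i,F(x_{i+1},\ldots,x_{i+n}),x_{i+n+1},\ldots,x_{2n-1})$. $F$ is idempotent if $F(a,\ldots,a)=a$ for all $a\in X$. $F$ is monotone increasing if it is (non-strictly) order-preserving in each variable. An element $e\in X$ is a neutral element of $F$ if $F(e,\ldots,e,x,e,\ldots,e)=x$ for every $x\in X$ and every position $i=1,\ldots,n$ of $x$. The interval $I$ is not necessarily bounded. *)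

theory Defs
  imports "HOL-Analysis.Analysis"
begin

text \<open>
  An \<open>n\<close>-ary operation on \<open>X\<close> is represented by a function \<open>F :: 'a list \<Rightarrow> 'a\<close>. Only the values
  of \<open>F\<close> on lists in \<open>tuples n X\<close> matter. The tuple \<open>(x\<^sub>1, \<dots>, x\<^sub>n)\<close> is the list \<open>xs\<close> with
  \<open>x\<^sub>k = xs ! (k - 1)\<close>, so positions are counted from 0.
\<close>

definition tuples :: "nat \<Rightarrow> 'a set \<Rightarrow> 'a list set" where
  "tuples n X = {xs. length xs = n \<and> set xs \<subseteq> X}"

definition nary_operation :: "nat \<Rightarrow> 'a set \<Rightarrow> ('a list \<Rightarrow> 'a) \<Rightarrow> bool" where
  "nary_operation n X F \<longleftrightarrow> (\<forall>xs \<in> tuples n X. F xs \<in> X)"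

text \<open>
  In \<open>nary_associative\<close>, for \<open>xs = (x\<^sub>1, \<dots>, x\<^bsub>2n-1\<^esub>)\<close>, \<open>take n (drop i xs)\<close> is
  \<open>(x\<^bsub>i+1\<^esub>, \<dots>, x\<^bsub>i+n\<^esub>)\<close> and \<open>drop (i + n) xs\<close> is \<open>(x\<^bsub>i+n+1\<^esub>, \<dots>, x\<^bsub>2n-1\<^esub>)\<close>.
\<close>

definition nary_associative :: "nat \<Rightarrow> 'a set \<Rightarrow> ('a list \<Rightarrow> 'a) \<Rightarrow> bool" where
  "nary_associative n X F \<longleftrightarrow>
     (\<forall>xs \<in> tuples (2 * n - 1) X. \<forall>i \<in> {1..n - 1}.
        F (F (take n xs) # drop n xs) =
        F (take i xs @ F (take n (drop i xs)) # drop (i + n) xs))"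

definition nary_idempotent :: "nat \<Rightarrow> 'a set \<Rightarrow> ('a list \<Rightarrow> 'a) \<Rightarrow> bool" where
  "nary_idempotent n X F \<longleftrightarrow> (\<forall>a \<in> X. F (replicate n a) = a)"

definition nary_monotone :: "nat \<Rightarrow> 'a::order set \<Rightarrow> ('a list \<Rightarrow> 'a) \<Rightarrow> bool" where
  "nary_monotone n X F \<longleftrightarrow>
     (\<forall>xs \<in> tuples n X. \<forall>i < n. \<forall>y \<in> X. xs ! i \<le> y \<longrightarrow> F xs \<le> F (xs[i := y]))"

definition nary_neutral :: "nat \<Rightarrow> 'a set \<Rightarrow> ('a list \<Rightarrow> 'a) \<Rightarrow> 'a \<Rightarrow> bool" where
  "nary_neutral n X F e \<longleftrightarrow>
     e \<in> X \<and> (\<forall>x \<in> X. \<forall>i < n. F ((replicate n e)[i := x]) = x)"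

definition nary_quasitrivial :: "nat \<Rightarrow> 'a set \<Rightarrow> ('a list \<Rightarrow> 'a) \<Rightarrow> bool" where
  "nary_quasitrivial n X F \<longleftrightarrow> (\<forall>xs \<in> tuples n X. F xs \<in> set xs)"

end

theory Submission
  imports Defs
begin

text \<open>
  Put \<open>x \<circ> y = F (x, e, \<dots>, e, y)\<close>. Because \<open>e\<close> is neutral, \<open>n\<close>-associativity makes \<open>\<circ>\<close>
  associative and \<open>F (x\<^sub>1, \<dots>, x\<^sub>n) = x\<^sub>1 \<circ> \<dots> \<circ> x\<^sub>n\<close>, so it suffices that \<open>\<circ>\<close> is quasitrivial.
  By monotonicity and idempotency \<open>\<circ>\<close> is the maximum above \<open>e\<close> and the minimum below \<open>e\<close>. If
  \<open>a \<le> e \<le> b\<close>, then \<open>c = a \<circ> b\<close> satisfies \<open>a \<le> c \<le> b\<close> and \<open>a \<circ> c = c = c \<circ> b\<close>. Hence \<open>c = max c b = b\<close>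
  when \<open>c \<ge> e\<close>, and \<open>c = min a c = a\<close> when \<open>c \<le> e\<close>; the case \<open>b \<le> e \<le> a\<close> is symmetric.
\<close>

lemma monotone_idempotent_monoid_quasitrivial:
  fixes f :: "'a::linorder \<Rightarrow> 'a \<Rightarrow> 'a"
  assumes closed: "\<And>x y. x \<in> X \<Longrightarrow> y \<in> X \<Longrightarrow> f x y \<in> X"
    and assoc: "\<And>x y z. x \<in> X \<Longrightarrow> y \<in> X \<Longrightarrow> z \<in> X \<Longrightarrow> f (f x y) z = f x (f y z)"
    and mono: "\<And>x x' y y'. x \<in> X \<Longrightarrow> x' \<in> X \<Longrightarrow> y \<in> X \<Longrightarrow> y' \<in> X \<Longrightarrow>
                 x \<le> x' \<Longrightarrow> y \<le> y' \<Longrightarrow> f x y \<le> f x' y'"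
    and idem: "\<And>x. x \<in> X \<Longrightarrow> f x x = x"
    and e: "e \<in> X" and left: "\<And>x. x \<in> X \<Longrightarrow> f e x = x" and right: "\<And>x. x \<in> X \<Longrightarrow> f x e = x"
    and xy: "x \<in> X" "y \<in> X"
  shows "f x y \<in> {x, y}"
proof -
  have le_max: "f a b \<le> max a b" if "a \<in> X" "b \<in> X" for a b
  proof -
    have "f a b \<le> f (max a b) (max a b)"
      using that by (intro mono) (auto simp: max_def)
    then show ?thesis
      using that idem by (auto simp: max_def)
  qed
  have min_le: "min a b \<le> f a b" if "a \<in> X" "b \<in> X" for a b
  proof -
    have "f (min a b) (min a b) \<le> f a b"
      using that by (intro mono) (auto simp: min_def)
    then show ?thesis
      using that idem by (auto simp: min_def)
  qed
  have max: "f a b = max a b" if "a \<in> X" "b \<in> X" "e \<le> a" "e \<le> b" for a b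
  proof (rule antisym)
    show "f a b \<le> max a b"
      using that le_max by simp
    \<comment> \<open>Replacing one argument by \<open>e\<close> can only decrease the value:
      \<open>a = f a e\<close> and \<open>b = f e b\<close> both lie below
      \<open>f a b\<close>.\<close>
    show "max a b \<le> f a b"
      using mono[of a a e b] mono[of e a b b] that e left right by simp
  qed
  have min: "f a b = min a b" if "a \<in> X" "b \<in> X" "a \<le> e" "b \<le> e" for a b
  proof (rule antisym)
    show "min a b \<le> f a b"
      using that min_le by simp
    show "f a b \<le> min a b"
      using mono[of a a b e] mono[of a e b b] that e left right by simp
  qed
  define c where "c = f x y"
  \<comment> \<open>Absorption: \<open>f x (f x y) = f (f x x) y\<close>, and idempotency removes
    the repeated \<open>x\<close>; the same works for \<open>y\<close> on the right.\<close>
  have c: "c \<in> X" "f x c = c" "f c y = c"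
    using closed assoc idem xy by (simp_all add: c_def flip: assoc) (simp add: assoc idem)
  have bounds: "min x y \<le> c" "c \<le> max x y"
    using min_le le_max xy by (simp_all add: c_def)
  consider "e \<le> x" "e \<le> y" | "x \<le> e" "y \<le> e" | "x \<le> e" "e \<le> y" | "e \<le> x" "y \<le> e"
    by fastforce
  then have "c = x \<or> c = y"
  proof cases
    case 1
    then show ?thesis using max[of x y] xy by (auto simp: c_def max_def)
  next
    case 2
    then show ?thesis using min[of x y] xy by (auto simp: c_def min_def)
  next
    case 3
    then show ?thesis
      using max[of c y] min[of x c] c xy bounds
      by (cases e c rule: le_cases) (auto simp: max_def min_def split: if_splits)
  next
    case 4
    then show ?thesis
      using max[of x c] min[of c y] c xy bounds
      by (cases e c rule: le_cases) (auto simp: max_def min_def split: if_splits)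
  qed
  then show ?thesis by (simp add: c_def)
qed

text \<open>The definition only compares the leftmost block with each later one, so two arbitrary
  blocks are compared by way of the leftmost. A block that is itself leftmost
  (\<open>as = []\<close>) is trivial and falls outside the range \<open>{1..n - 1}\<close>.\<close>

lemma nary_associativeD:
  assumes "nary_associative n X F"
    and "us @ ws @ vs = us' @ ws' @ vs'" and "set (us @ ws @ vs) \<subseteq> X"
    and "length ws = n" "length ws' = n" "length (us @ vs) = n - 1" "n \<ge> 1"
  shows "F (us @ F ws # vs) = F (us' @ F ws' # vs')"
proof -
  have *: "F (as @ F bs # cs) = F (F (take n (as @ bs @ cs)) # drop n (as @ bs @ cs))"
    if "set (as @ bs @ cs) \<subseteq> X" "length bs = n" "length (as @ cs) = n - 1"
    for as bs cs :: "'a list"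
  proof (cases "as = []")
    case True
    then show ?thesis using that by simp
  next
    case False
    have "as @ bs @ cs \<in> tuples (2 * n - 1) X"
      using that \<open>n \<ge> 1\<close> by (auto simp: tuples_def)
    moreover have "length as \<in> {1..n - 1}"
      using False that by (cases as) auto
    ultimately show ?thesis
      using assms(1) that unfolding nary_associative_def by fastforce
  qed
  have "length (us' @ vs') = n - 1"
    using arg_cong[OF assms(2), of length] assms(4-6) by simp
  then show ?thesis
    using *[of us ws vs] *[of us' ws' vs'] assms by simp
qed

lemma nary_monotone_list_all2:
  assumes mono: "nary_monotone n X F" and "xs \<in> tuples n X" "ys \<in> tuples n X"
    and le: "list_all2 (\<le>) xs ys"
  shows "F xs \<le> F ys"
proof -
  have len: "length xs = n" "length ys = n" and sub: "set xs \<subseteq> X" "set ys \<subseteq> X"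
    using assms by (auto simp: tuples_def)
  \<comment> \<open>Coordinates are raised one at a time; the intermediate list agrees with
    \<open>ys\<close> in the first \<open>k\<close> places and with \<open>xs\<close> after
    them.\<close>
  have "F xs \<le> F (take k ys @ drop k xs)" if "k \<le> n" for k
    using that
  proof (induction k)
    case (Suc k)
    let ?zs = "take k ys @ drop k xs"
    have "?zs \<in> tuples n X"
      using Suc.prems len sub set_take_subset[of k ys] set_drop_subset[of k xs]
      by (auto simp: tuples_def)
    moreover have "?zs ! k \<le> ys ! k" "ys ! k \<in> X"
      using Suc.prems len sub list_all2_nthD[OF le, of k] by (auto simp: nth_append)
    ultimately have "F ?zs \<le> F (?zs[k := ys ! k])"
      using mono Suc.prems unfolding nary_monotone_def by auto
    moreover have "?zs[k := ys ! k] = take (Suc k) ys @ drop (Suc k) xs"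
      using Suc.prems len
      by (simp add: list_update_append take_Suc_conv_app_nth flip: Cons_nth_drop_Suc)
    ultimately show ?case
      using Suc by simp
  qed simp
  from this[of n] show ?thesis using len by simp
qed

lemma nary_neutralD:
  assumes "nary_neutral n X F e" and "x \<in> X" and "k + m + 1 = n"
  shows "F (replicate k e @ x # replicate m e) = x"
proof -
  have "(replicate n e)[k := x] = replicate k e @ x # replicate m e"
    by (rule nth_equalityI) (use assms(3) in \<open>auto simp: nth_list_update nth_append nth_Cons'\<close>)
  then show ?thesis
    using assms unfolding nary_neutral_def by (metis add.commute less_add_Suc1 Suc_eq_plus1 add_Suc)
qed

definition binary_reduct :: "nat \<Rightarrow> ('a list \<Rightarrow> 'a) \<Rightarrow> 'a \<Rightarrow> 'a \<Rightarrow> 'a \<Rightarrow> 'a" where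
  "binary_reduct n F e x y = F (x # replicate (n - 2) e @ [y])"

text \<open>Both sides evaluate the same word of length \<open>2 * n - 1\<close>, namely
  \<open>x\<close>, \<open>n - 2\<close> copies of \<open>e\<close>, \<open>y\<close>,
  \<open>n - 2\<close> copies of \<open>e\<close>, \<open>z\<close>, with the inner block placed
  first or last.\<close>

lemma binary_reduct_assoc:
  assumes "nary_associative n X F" and "n \<ge> 2" and "{x, y, z, e} \<subseteq> X"
  shows "binary_reduct n F e (binary_reduct n F e x y) z =
         binary_reduct n F e x (binary_reduct n F e y z)"
proof -
  have "set (replicate (n - 2) e) \<subseteq> X" "Suc (n - 2) = n - Suc 0"
    using assms by auto
  then show ?thesis
    using nary_associativeD[OF assms(1),
        of "[]" "x # replicate (n - 2) e @ [y]" "replicate (n - 2) e @ [z]"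
           "x # replicate (n - 2) e" "y # replicate (n - 2) e @ [z]" "[]"] assms(2,3)
    by (simp add: binary_reduct_def)
qed

text \<open>In the word \<open>ys\<close>, \<open>x\<close>, \<open>n - 2\<close> copies of
  \<open>e\<close>, \<open>y\<close>, \<open>Suc k\<close> copies of \<open>e\<close>, the block
  from \<open>x\<close> to \<open>y\<close> yields the reduct, while the block starting one place
  later collapses to \<open>y\<close> by neutrality.\<close>

lemma nary_merge_last:
  assumes "nary_associative n X F" and "nary_neutral n X F e"
    and "set ys \<subseteq> X" "x \<in> X" "y \<in> X" "length ys + k + 2 = n"
  shows "F (ys @ [x, y] @ replicate k e) =
         F (ys @ binary_reduct n F e x y # replicate (Suc k) e)"
proof -
  have e: "e \<in> X" and y: "F (replicate (n - 2) e @ [y, e]) = y"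
    using assms nary_neutralD[of n X F e y "n - 2" 1] by (auto simp: nary_neutral_def)
  have "set (replicate m e) \<subseteq> X" for m
    using e by auto
  then show ?thesis
    using nary_associativeD[OF assms(1),
        of ys "x # replicate (n - 2) e @ [y]" "replicate (Suc k) e"
           "ys @ [x]" "replicate (n - 2) e @ [y, e]" "replicate k e"] assms(3-) e y
    by (auto simp: binary_reduct_def)
qed

lemma binary_reduct_quasitrivial:
  fixes X :: "'a::linorder set"
  assumes n: "n \<ge> 2" and op: "nary_operation n X F" and assoc: "nary_associative n X F"
    and mono: "nary_monotone n X F" and idem: "nary_idempotent n X F"
    and neutral: "nary_neutral n X F e" and xy: "x \<in> X" "y \<in> X"
  shows "binary_reduct n F e x y \<in> {x, y}"
proof -
  let ?f = "binary_reduct n F e"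
  have e: "e \<in> X" using neutral by (simp add: nary_neutral_def)
  have tuple: "a # replicate (n - 2) c @ [b] \<in> tuples n X" if "{a, b, c} \<subseteq> X" for a b c
    using that n by (auto simp: tuples_def)
  have right: "?f a e = a" if "a \<in> X" for a
    using nary_neutralD[OF neutral that, of 0 "n - 1"] n
    by (auto simp: binary_reduct_def replicate_append_same numeral_2_eq_2 Suc_diff_Suc
             simp flip: replicate_Suc)
  have left: "?f e a = a" if "a \<in> X" for a
    using nary_neutralD[OF neutral that, of "n - 1" 0] n
    by (simp add: binary_reduct_def numeral_2_eq_2 Suc_diff_Suc
             flip: append_Cons replicate_Suc)
  have le: "F (a # replicate (n - 2) c @ [b]) \<le> F (a' # replicate (n - 2) c' @ [b'])"
    if "{a, b, c} \<subseteq> X" "{a', b', c'} \<subseteq> X" "a \<le> a'" "b \<le> b'" "c \<le> c'" for a b c a' b' c'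
    using that
    by (intro nary_monotone_list_all2[OF mono] tuple)
       (auto simp: list_all2_conv_all_nth nth_append nth_Cons')
  \<comment> \<open>Idempotency of \<open>F\<close> concerns a middle part filled with
    \<open>a\<close>, not with \<open>e\<close>. If \<open>e \<le> a\<close>, monotonicity gives
    \<open>a = ?f a e \<le> ?f a a \<le> F (replicate n a) = a\<close>; the case
    \<open>a \<le> e\<close> reverses all inequalities.\<close>
  have idem': "?f a a = a" if a: "a \<in> X" for a
  proof -
    have "replicate n a = a # replicate (n - 2) a @ [a]"
      using n by (simp add: replicate_append_same numeral_2_eq_2 Suc_diff_Suc flip: replicate_Suc)
    then have "F (a # replicate (n - 2) a @ [a]) = a"
      using idem a unfolding nary_idempotent_def by metis
    then show ?thesis
      using le[of a a e a a a] le[of a a a a a e] le[of a a e a e e] le[of a e e a a e]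
        right[OF a] a e
      by (cases e a rule: le_cases) (auto simp: binary_reduct_def)
  qed
  show ?thesis
  proof (rule monotone_idempotent_monoid_quasitrivial[where X = X and e = e])
    show "?f a b \<in> X" if "a \<in> X" "b \<in> X" for a b
      using op tuple[of a b e] that e by (simp add: binary_reduct_def nary_operation_def)
    show "?f (?f a b) c = ?f a (?f b c)" if "a \<in> X" "b \<in> X" "c \<in> X" for a b c
      using binary_reduct_assoc[OF assoc n] that e by simp
    show "?f a b \<le> ?f a' b'"
      if "a \<in> X" "a' \<in> X" "b \<in> X" "b' \<in> X" "a \<le> a'" "b \<le> b'" for a a' b b'
      using le[of a b e a' b' e] that e by (simp add: binary_reduct_def)
  qed (use idem' left right e xy in auto)
qed

lemma nary_quasitrivial_if_neutral:
  fixes X :: "'a::linorder set"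
  assumes n: "n \<ge> 2" and op: "nary_operation n X F" and assoc: "nary_associative n X F"
    and mono: "nary_monotone n X F" and idem: "nary_idempotent n X F"
    and neutral: "nary_neutral n X F e"
  shows "nary_quasitrivial n X F"
proof -
  \<comment> \<open>Generalizing to tuples padded with \<open>e\<close> enables induction: merging
    the last two proper entries shortens \<open>xs\<close> and adds one \<open>e\<close>, and the
    merged value is again one of the two. The claim is the case \<open>k = 0\<close>.\<close>
  have pad: "F (xs @ replicate k e) \<in> set xs"
    if "length xs = Suc m" "m + k + 1 = n" "set xs \<subseteq> X" for xs m k
    using that
  proof (induction m arbitrary: xs k)
    case 0
    then obtain x where "xs = [x]" by (auto simp: length_Suc_conv)
    then show ?case
      using nary_neutralD[OF neutral, of x 0 k] 0 by auto
  next
    case (Suc m)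
    obtain ys x y where xs: "xs = ys @ [x, y]"
    proof -
      from Suc.prems(1) obtain zs y where "xs = zs @ [y]" "length zs = Suc m"
        by (cases xs rule: rev_cases) auto
      then show thesis
        using that by (cases zs rule: rev_cases) auto
    qed
    let ?z = "binary_reduct n F e x y"
    have z: "?z \<in> {x, y}"
      using binary_reduct_quasitrivial[OF assms] Suc.prems xs by simp
    have "F (xs @ replicate k e) = F ((ys @ [?z]) @ replicate (Suc k) e)"
      using nary_merge_last[OF assoc neutral, of ys x y k] Suc.prems xs by simp
    also have "\<dots> \<in> set (ys @ [?z])"
      using z Suc.prems xs by (intro Suc.IH) auto
    finally show ?case using z xs by auto
  qed
  show ?thesis
    unfolding nary_quasitrivial_def
  proof
    fix xs assume "xs \<in> tuples n X"
    then show "F xs \<in> set xs"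
      using pad[of xs "n - 1" 0] n by (auto simp: tuples_def)
  qed
qed

theorem theorem2p4:
  fixes I :: "real set" and n :: nat and F :: "real list \<Rightarrow> real"
  assumes "is_interval I" and "I \<noteq> {}" and "n \<ge> 2"
    and "nary_operation n I F"
    and "nary_associative n I F"
    and "nary_monotone n I F"
    and "nary_idempotent n I F"
    and "\<exists>e. nary_neutral n I F e"
  shows "nary_quasitrivial n I F"
  using nary_quasitrivial_if_neutral assms(3-) by blast

end
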